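(* Let $K\in\mathbb{N}$, and let $\theta\in\mathbb{R}$ and $\Delta(0),\dots,\Delta(K-1)\in\mathbb{R}$ satisfy $$m(b_0)=\frac{\theta}{\lambda},\qquad m(b_i)+\sum_{j=0}^{i-1}a_{i,j}\Delta(j)=\frac{\theta}{\lambda}\ \ (1\le i\le K-1),\qquad \sum_{j=0}^{K-1}a_{K,j}\Delta(j)=\frac{\theta}{\lambda},$$ where $$b_i=\sum_{j=0}^{i-1}(a_{i,j}-a_{i+1,j})\Delta(j)+\alpha_{i+1,0}\Delta(i),\qquad 0\le i\le K-1.$$ Let $(u_0^*,\dots,u_{K-1}^* )$ be the optimal price vector, where $u_i^*\in\arg\max_u (u-b_i)\overline{G}(u)$ for $0\le i\le K-1$. Then: (a) the optimal revenue rate satisfies $\theta\ge0$; (b) the sequence $(\Delta(i))_{0\le i\le K-1}$ is positive and increasing in $i$, and the sequence $(b_i)_{0\le i\le K-1}$ is also positive and increasing in $i$; (c) the optimal price vector $(u_i^* )_{0\le i\le K-1}$ is increasing in $i$.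
   Context: $V$ is a positive random variable with continuous distribution function $G$ and finite mean, $\overline{G}(u)=P(V\ge u)$ for $u\in\mathbb{R}$, and for $B\in\mathbb{R}$, $m(B)=\max_u (u-B)\overline{G}(u)$. $U$ is a nonnegative random variable (interarrival time) with a density and mean $1/\lambda\in(0,\infty)$, and $\mu>0$ is the service rate. For $0\le i\le k$, $\alpha_{k,i}=\mathbb{E}\big[\binom{k}{i}(1-e^{-\mu U})^i e^{-(k-i)\mu U}\big]$ is the probability of $i$ departures from $k$ busy servers during an interarrival time. For $0\le j\le i$, $a_{i,j}=\sum_{l=0}^{j}\alpha_{i,i-l}$. The displayed system is the optimality (Bellman) equation for maximizing the long-run average revenue in a $K$-server loss system with renewal arrivals (interarrival times distributed as $U$), exponential($\mu$) service times and i.i.d. valuations distributed as $V$, where the price depends on the number $i$ of busy servers seen by an arrival; $\theta$ is the optimal revenue rate, and the optimal price in state $i$ is a maximizer $u_i^*$ of $(u-b_i)\overline{G}(u)$. *)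

theory Defs
  imports "HOL-Probability.Probability"
begin

definition survival :: "'a measure \<Rightarrow> ('a \<Rightarrow> real) \<Rightarrow> real \<Rightarrow> real" where
  "survival M V u = measure M {\<omega> \<in> space M. V \<omega> \<ge> u}"

definition max_profit :: "'a measure \<Rightarrow> ('a \<Rightarrow> real) \<Rightarrow> real \<Rightarrow> real" where
  "max_profit M V B = (GREATEST r. r \<in> range (\<lambda>u. (u - B) * survival M V u))"

text \<open>The operator \<^const>\<open>Greatest\<close> is unspecified without a maximum; whenever a maximizer
  exists, \<^const>\<open>max_profit\<close> is the maximal value.\<close>

lemma max_profit_eq:
  assumes "is_arg_max (\<lambda>v. (v - B) * survival M V v) (\<lambda>_. True) u"
  shows "max_profit M V B = (u - B) * survival M V u"
  unfolding max_profit_def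
  by (rule Greatest_equality) (use assms in \<open>auto simp: is_arg_max_linorder\<close>)

text \<open>Departures from \<open>k\<close> busy servers during one interarrival time \<open>U\<close>: conditionally on \<open>U\<close>,
  their number is binomial with success probability \<open>1 - exp (- \<mu> U)\<close>.\<close>

definition departure_prob ::
  "'a measure \<Rightarrow> ('a \<Rightarrow> real) \<Rightarrow> real \<Rightarrow> nat \<Rightarrow> nat \<Rightarrow> real" where
  "departure_prob M U \<mu> k i =
     (LINT \<omega>|M. real (k choose i) * (1 - exp (- \<mu> * U \<omega>)) ^ i * exp (- real (k - i) * \<mu> * U \<omega>))"

text \<open>The following is meaningful only for \<open>j \<le> i\<close> (natural-number subtraction \<open>i - l\<close>).\<close>

definition remaining_le_prob ::
  "'a measure \<Rightarrow> ('a \<Rightarrow> real) \<Rightarrow> real \<Rightarrow> nat \<Rightarrow> nat \<Rightarrow> real" where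
  "remaining_le_prob M U \<mu> i j = (\<Sum>l\<le>j. departure_prob M U \<mu> i (i - l))"

definition opportunity_cost ::
  "'a measure \<Rightarrow> ('a \<Rightarrow> real) \<Rightarrow> real \<Rightarrow> (nat \<Rightarrow> real) \<Rightarrow> nat \<Rightarrow> real" where
  "opportunity_cost M U \<mu> \<Delta> i =
     (\<Sum>j<i. (remaining_le_prob M U \<mu> i j - remaining_le_prob M U \<mu> (i + 1) j) * \<Delta> j)
     + departure_prob M U \<mu> (i + 1) 0 * \<Delta> i"

end

theory Submission imports Defs begin

text \<open>With \<open>p = exp (- \<mu> U)\<close> and \<open>B\<^sub>i\<close> conditionally binomial \<open>(i, p)\<close>, the opportunity cost is
  \<open>b\<^sub>i = E (p \<Delta> (B\<^sub>i))\<close>, a nonnegative combination of \<open>\<Delta> 0, \<dots>, \<Delta> i\<close> with total weight \<open>E p < 1\<close>.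
  Subtracting consecutive Bellman equations gives \<open>\<Delta> i = b\<^sub>i + m (b\<^sub>i) - m (b\<^sub>i\<^sub>+\<^sub>1)\<close>, where the last
  term is absent for \<open>i = K - 1\<close>. Since \<open>m\<close> is nonincreasing and 1-Lipschitz, \<open>\<Delta> i\<close> lies
  between \<open>b\<^sub>i\<close> and \<open>b\<^sub>i\<^sub>+\<^sub>1\<close>. A minimum principle then makes \<open>\<Delta>\<close> positive, and inductively
  \<open>b\<^sub>i < \<Delta> i\<close> forces \<open>\<Delta> i \<le> b\<^sub>i\<^sub>+\<^sub>1 < max (\<Delta> 0, \<dots>, \<Delta> (i + 1))\<close>, so \<open>\<Delta> i < \<Delta> (i + 1)\<close>.\<close>

section \<open>Optimal margin and optimal price as functions of the cost\<close>

text \<open>Trying each optimal price at the other cost changes its margin by \<open>y - x\<close>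
  times a value of \<open>g\<close> in [0,1]. A positive margin forces \<open>g t > 0\<close>, which
  makes the comparison strict.\<close>

lemma is_arg_max_margin_bounds:
  fixes g :: "real \<Rightarrow> real"
  assumes g: "\<And>v. 0 \<le> g v" "\<And>v. g v \<le> 1"
    and x: "is_arg_max (\<lambda>v. (v - x) * g v) (\<lambda>_. True) s"
    and y: "is_arg_max (\<lambda>v. (v - y) * g v) (\<lambda>_. True) t"
    and "x \<le> y"
  shows "(t - y) * g t \<le> (s - x) * g s"
    and "(s - x) * g s \<le> (t - y) * g t + (y - x)"
    and "x < y \<Longrightarrow> 0 < (t - y) * g t \<Longrightarrow> (t - y) * g t < (s - x) * g s"
proof -
  have s: "(v - x) * g v \<le> (s - x) * g s" for v
    using x by (auto simp: is_arg_max_linorder)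
  have t: "(v - y) * g v \<le> (t - y) * g t" for v
    using y by (auto simp: is_arg_max_linorder)
  have *: "(t - x) * g t = (t - y) * g t + (y - x) * g t" by (simp add: algebra_simps)
  have "0 \<le> (y - x) * g t" using g(1)[of t] \<open>x \<le> y\<close> by simp
  then show "(t - y) * g t \<le> (s - x) * g s" using s[of t] * by linarith
  have "(y - x) * g s \<le> (y - x) * 1"
    using g(2)[of s] \<open>x \<le> y\<close> by (intro mult_left_mono) auto
  moreover have "(s - x) * g s = (s - y) * g s + (y - x) * g s" by (simp add: algebra_simps)
  ultimately show "(s - x) * g s \<le> (t - y) * g t + (y - x)" using t[of s] by simp
  assume "x < y" "0 < (t - y) * g t"
  then have "g t \<noteq> 0" by auto
  then have "0 < (y - x) * g t" using g(1)[of t] \<open>x < y\<close> by (simp add: order_less_le)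
  then show "(t - y) * g t < (s - x) * g s" using s[of t] * by linarith
qed

text \<open>Positivity of the margin is essential: once it vanishes, every large enough price is a
  maximizer.\<close>

lemma is_arg_max_margin_mono:
  fixes g :: "real \<Rightarrow> real"
  assumes g: "\<And>v. 0 \<le> g v" "antimono g"
    and x: "is_arg_max (\<lambda>v. (v - x) * g v) (\<lambda>_. True) s"
    and y: "is_arg_max (\<lambda>v. (v - y) * g v) (\<lambda>_. True) t"
    and "x < y" and pos: "0 < (t - y) * g t"
  shows "s \<le> t"
proof (rule ccontr)
  assume "\<not> s \<le> t"
  then have "g s \<le> g t" using g(2) by (simp add: antimonoD)
  have 1: "(t - x) * g t \<le> (s - x) * g s" using x by (auto simp: is_arg_max_linorder)
  have 2: "(s - y) * g s \<le> (t - y) * g t" using y by (auto simp: is_arg_max_linorder)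
  \<comment> \<open>Adding the two optimality inequalities leaves only this cross term.\<close>
  have "0 \<le> (y - x) * (g s - g t)" using 1 2 by (simp add: algebra_simps)
  then have "g s = g t" using \<open>g s \<le> g t\<close> \<open>x < y\<close> by (simp add: zero_le_mult_iff)
  \<comment> \<open>With equal positive values of \<open>g\<close>, the higher price
    \<open>s\<close> would beat \<open>t\<close> at cost \<open>y\<close>.\<close>
  moreover have "g t > 0" using pos g(1)[of t] by (cases "g t = 0") auto
  ultimately show False using 2 \<open>\<not> s \<le> t\<close> by simp
qed

section \<open>Deterministic core: positivity and monotonicity\<close>

text \<open>Here \<open>w i\<close> stands for the optimal margin at cost \<open>b i\<close>, and
  the hypotheses on \<open>w\<close> record how m depends on its argument. Positivity of
  \<open>w\<close> is among the conclusions because monotonicity of the prices rests on it.\<close>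

lemma marginal_values_increasing:
  fixes c :: "nat \<Rightarrow> nat \<Rightarrow> real" and \<Delta> b w :: "nat \<Rightarrow> real"
  assumes c: "\<And>i j. j \<le> i \<Longrightarrow> 0 \<le> c i j" "\<And>i. 0 < c i i" "\<And>i. (\<Sum>j\<le>i. c i j) = q" "q < 1"
    and b: "\<And>i. i < K \<Longrightarrow> b i = (\<Sum>j\<le>i. c i j * \<Delta> j)"
    and step: "\<And>i. Suc i < K \<Longrightarrow> \<Delta> i = b i + w i - w (Suc i)"
    and last: "\<And>i. Suc i = K \<Longrightarrow> \<Delta> i = b i + w i"
    and w_nonneg: "\<And>i. i < K \<Longrightarrow> 0 \<le> w i"
    and w_mono: "\<And>i j. i < K \<Longrightarrow> j < K \<Longrightarrow> b i \<le> b j \<Longrightarrow> w j \<le> w i"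
    and w_lip: "\<And>i j. i < K \<Longrightarrow> j < K \<Longrightarrow> b i \<le> b j \<Longrightarrow> w i \<le> w j + (b j - b i)"
    and w_strict: "\<And>i j. i < K \<Longrightarrow> j < K \<Longrightarrow> b i < b j \<Longrightarrow> 0 < w j \<Longrightarrow> w j < w i"
    and w_pos: "\<And>i. i < K \<Longrightarrow> b i \<le> 0 \<Longrightarrow> 0 < w i"
  shows "\<And>i. i < K \<Longrightarrow> 0 < \<Delta> i"
    and "\<And>i. i < K \<Longrightarrow> 0 < b i" and "\<And>i. i < K \<Longrightarrow> 0 < w i"
    and "strict_mono_on {..<K} \<Delta>" and "strict_mono_on {..<K} b"
proof -
  have q: "0 < q" using c(2,3)[of 0] by simp
  have b_ge: "q * d \<le> b i" if "i < K" "\<And>j. j \<le> i \<Longrightarrow> d \<le> \<Delta> j" for i d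
  proof -
    have "q * d = (\<Sum>j\<le>i. c i j * d)" using c(3)[of i] by (simp add: sum_distrib_right[symmetric])
    also have "\<dots> \<le> b i"
      unfolding b[OF that(1)] by (intro sum_mono mult_left_mono that c(1)) auto
    finally show ?thesis .
  qed
  have b_le: "b i \<le> q * d" if "i < K" "\<And>j. j \<le> i \<Longrightarrow> \<Delta> j \<le> d" for i d
  proof -
    have "b i \<le> (\<Sum>j\<le>i. c i j * d)"
      unfolding b[OF that(1)] by (intro sum_mono mult_left_mono that c(1)) auto
    also have "\<dots> = q * d" using c(3)[of i] by (simp add: sum_distrib_right[symmetric])
    finally show ?thesis .
  qed
  \<comment> \<open>The difference \<open>\<Delta> i - b i = w i - w (Suc i)\<close> has weakly the
    sign of \<open>b (Suc i) - b i\<close> and at most its size.\<close>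
  have ge_min: "min (b i) (b (Suc i)) \<le> \<Delta> i" if "Suc i < K" for i
    using step[OF that] w_mono[of i "Suc i"] w_lip[of "Suc i" i] that
    by (cases "b i \<le> b (Suc i)") auto
  have le_max: "\<Delta> i \<le> max (b i) (b (Suc i))" if "Suc i < K" for i
    using step[OF that] w_mono[of "Suc i" i] w_lip[of i "Suc i"] that
    by (cases "b i \<le> b (Suc i)") auto
  show pos: "0 < \<Delta> i" if "i < K" for i
  proof (rule ccontr)
    assume neg: "\<not> 0 < \<Delta> i"
    define d where "d = Min (\<Delta> ` {..<K})"
    have d_le: "d \<le> \<Delta> j" if "j < K" for j unfolding d_def using that by auto
    have "d \<le> 0" using d_le[OF that] neg by simp
    have "d \<in> \<Delta> ` {..<K}" unfolding d_def using that by (intro Min_in) auto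
    then have ex: "\<exists>n. n < K \<and> \<Delta> n = d" by auto
    \<comment> \<open>Taking the last minimizer excludes the degenerate case of minimum zero.\<close>
    define k where "k = (GREATEST n. n < K \<and> \<Delta> n = d)"
    have k: "k < K" "\<Delta> k = d"
      using GreatestI_ex_nat[OF ex, of K] unfolding k_def by auto
    have k_max: "\<Delta> n \<noteq> d" if "n < K" "k < n" for n
      using Greatest_le_nat[of "\<lambda>n. n < K \<and> \<Delta> n = d" n K] that unfolding k_def by auto
    have b_lower: "q * d \<le> b j" if "j < K" for j
      using that d_le by (intro b_ge) auto
    have b_le_d: "\<exists>j<K. b j \<le> d"
    proof (cases "Suc k < K")
      case True
      have "b k \<le> d \<or> b (Suc k) \<le> d" using ge_min[OF True] k by (simp add: min_le_iff_disj)
      then show ?thesis using k(1) True by blast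
    next
      case False
      then have "Suc k = K" using k by simp
      then show ?thesis using last[of k] k w_nonneg[of k] by force
    qed
    \<comment> \<open>The bounds \<open>q * d \<le> b j \<le> d\<close> with \<open>q < 1\<close>
      exclude a negative minimum, so only \<open>d = 0\<close> remains.\<close>
    then have "q * d \<le> d" using b_lower by fastforce
    then have "d * (1 - q) \<ge> 0" by (simp add: algebra_simps)
    then have d0: "d = 0" using \<open>d \<le> 0\<close> c(4) by (simp add: zero_le_mult_iff)
    have b_nonneg: "0 \<le> b j" if "j < K" for j using b_lower[OF that] d0 by simp
    show False
    proof (cases "Suc k < K")
      case False
      then have "Suc k = K" using k by simp
      \<comment> \<open>Both summands are nonnegative, hence zero; but at cost zero the margin is
        positive.\<close>
      then have "b k + w k = 0" using last[of k] k d0 by simp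
      then show False using b_nonneg[OF k(1)] w_nonneg[OF k(1)] w_pos[OF k(1)] by linarith
    next
      case True
      have eq: "b k + w k = w (Suc k)" using step[OF True] k d0 by simp
      \<comment> \<open>Otherwise \<open>b k = 0\<close>, so \<open>w k = w (Suc k)\<close> is
        positive although the cost rises strictly, against \<open>w_strict\<close>.\<close>
      have "b (Suc k) \<le> 0"
      proof (rule ccontr)
        assume *: "\<not> b (Suc k) \<le> 0"
        have bk: "b k = 0" using ge_min[OF True] b_nonneg[OF k(1)] * k d0 by linarith
        then have "w (Suc k) < w k"
          using w_strict[of k "Suc k"] w_pos[of k] k True * eq by auto
        then show False using eq bk by simp
      qed
      \<comment> \<open>All terms of \<open>b (Suc k)\<close> are nonnegative, so its last one
        vanishes and \<open>Suc k\<close> is a later minimizer than \<open>k\<close>.\<close>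
      moreover have "c (Suc k) (Suc k) * \<Delta> (Suc k) \<le> b (Suc k)"
        unfolding b[OF True] using True d_le d0 c(1)
        by (intro member_le_sum) (auto intro!: mult_nonneg_nonneg)
      ultimately have "\<Delta> (Suc k) \<le> 0"
        using c(2)[of "Suc k"] by (smt (verit) mult_pos_pos)
      then show False using k_max[OF True] d_le[OF True] d0 by simp
    qed
  qed
  show b_pos: "0 < b i" if "i < K" for i
    unfolding b[OF that]
    using that pos c(1,2)
    by (intro sum_pos2[where i = i]) (auto intro!: mult_nonneg_nonneg intro: less_imp_le)
  \<comment> \<open>At a running maximum of \<open>\<Delta>\<close> the total weight
    \<open>q < 1\<close> pulls \<open>b i\<close> strictly below it.\<close>
  have below: "b i < \<Delta> i" if "i < K" "\<And>j. j \<le> i \<Longrightarrow> \<Delta> j \<le> \<Delta> i" for i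
  proof -
    have "b i \<le> q * \<Delta> i" by (intro b_le that)
    also have "\<dots> < 1 * \<Delta> i" using pos[OF that(1)] c(4) by (intro mult_strict_right_mono) auto
    finally show ?thesis by simp
  qed
  have next_b: "b i < b (Suc i) \<and> \<Delta> i \<le> b (Suc i)" if "Suc i < K" "b i < \<Delta> i" for i
  proof -
    have "\<Delta> i \<le> b (Suc i)" using le_max[OF that(1)] that(2) by linarith
    then show ?thesis using that(2) by simp
  qed
  \<comment> \<open>A drop after a running maximum \<open>\<Delta> i\<close> would keep
    \<open>b (Suc i) \<le> q * \<Delta> i < \<Delta> i\<close>, whereas \<open>next_b\<close> gives
    \<open>\<Delta> i \<le> b (Suc i)\<close>.\<close>
  have ind: "\<forall>j\<le>i. \<Delta> j \<le> \<Delta> i" if "i < K" for i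
    using that
  proof (induction i)
    case (Suc i)
    then have IH: "\<forall>j\<le>i. \<Delta> j \<le> \<Delta> i" by simp
    then have *: "\<Delta> i \<le> b (Suc i)" using next_b[of i] below[of i] Suc.prems by simp
    have "\<Delta> i \<le> \<Delta> (Suc i)"
    proof (rule ccontr)
      assume "\<not> \<Delta> i \<le> \<Delta> (Suc i)"
      then have "b (Suc i) \<le> q * \<Delta> i"
        using IH Suc.prems by (intro b_le) (auto simp: le_Suc_eq)
      also have "\<dots> < 1 * \<Delta> i"
        using pos[of i] c(4) Suc.prems by (intro mult_strict_right_mono) auto
      finally show False using * by simp
    qed
    then show ?case using IH by (auto simp: le_Suc_eq intro: order_trans)
  qed simp
  have b_less: "b i < \<Delta> i" if "i < K" for i using below ind that by blast
  have b_Suc: "b i < b (Suc i)" if "Suc i < K" for i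
    using next_b that b_less[of i] by simp
  have \<Delta>_Suc: "\<Delta> i < \<Delta> (Suc i)" if "Suc i < K" for i
    using next_b[of i] b_less[of i] b_less[of "Suc i"] that by simp
  have strict: "strict_mono_on {..<K} f" if "\<And>i. Suc i < K \<Longrightarrow> f i < f (Suc i)" for f :: "nat \<Rightarrow> real"
  proof (rule strict_mono_onI)
    fix r s assume "r \<in> {..<K}" "s \<in> {..<K}" "r < s"
    from \<open>r < s\<close> \<open>s \<in> {..<K}\<close> show "f r < f s"
    proof (induction rule: strict_inc_induct)
      case (base i) then show ?case using that by simp
    next
      case (step i)
      then show ?case using that[of i] by fastforce
    qed
  qed
  show "strict_mono_on {..<K} \<Delta>" by (rule strict) (rule \<Delta>_Suc)
  show "strict_mono_on {..<K} b" by (rule strict) (rule b_Suc)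
  \<comment> \<open>By the recursion, \<open>w i\<close> is \<open>\<Delta> i - b i > 0\<close> plus
    the next margin, if there is one.\<close>
  show "0 < w i" if "i < K" for i
  proof (cases "Suc i < K")
    case True
    then show ?thesis using step[OF True] b_less[OF that] w_nonneg[OF True] by linarith
  next
    case False
    then show ?thesis using last[of i] b_less[OF that] that by simp
  qed
qed

section \<open>Binomial probabilities as Bernstein polynomials\<close>

lemma Bernstein_Suc_Suc:
  "Bernstein (Suc n) (Suc k) x = x * Bernstein n k x + (1 - x) * Bernstein n (Suc k) x"
proof (cases "Suc k \<le> n")
  case True
  then have "n - k = Suc (n - Suc k)" by simp
  then show ?thesis by (simp add: Bernstein_def algebra_simps)
next
  case False
  then show ?thesis by (cases "k = n") (auto simp: Bernstein_def algebra_simps)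
qed

text \<open>An additional trial pushes the success count past \<open>j\<close> exactly when the
  first \<open>n\<close> trials give \<open>j\<close> successes and the new one succeeds.\<close>

lemma sum_Bernstein_diff:
  "(\<Sum>l\<le>j. Bernstein n l x) - (\<Sum>l\<le>j. Bernstein (Suc n) l x) = x * Bernstein n j x"
proof (induction j)
  case 0
  show ?case by (simp add: Bernstein_def algebra_simps)
next
  case (Suc j)
  then show ?case by (simp add: Bernstein_Suc_Suc algebra_simps)
qed

section \<open>The survival function of the valuation\<close>

lemma survival_nonneg: "0 \<le> survival M V v"
  by (simp add: survival_def)

lemma survival_le_1: "prob_space M \<Longrightarrow> survival M V v \<le> 1"
  by (simp add: survival_def prob_space.prob_le_1)

lemma antimono_survival:
  assumes "prob_space M" "V \<in> borel_measurable M"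
  shows "antimono (survival M V)"
proof (rule antimonoI)
  interpret prob_space M by fact
  note assms(2)[measurable]
  fix x y :: real assume "x \<le> y"
  then show "survival M V y \<le> survival M V x"
    unfolding survival_def by (intro finite_measure_mono) auto
qed

text \<open>Otherwise V would almost surely lie below every \<open>1 / real (Suc n)\<close>. Such a
  price earns a positive margin at every cost that is at most zero.\<close>

lemma survival_pos_exists:
  assumes "prob_space M" "V \<in> borel_measurable M" "AE \<omega> in M. V \<omega> > 0"
  shows "\<exists>v>0. 0 < survival M V v"
proof (rule ccontr)
  interpret prob_space M by fact
  note assms(2)[measurable]
  assume "\<not> ?thesis"
  then have "prob {\<omega> \<in> space M. V \<omega> \<ge> v} = 0" if "v > 0" for v
    using that unfolding survival_def by (meson measure_le_0_iff not_less)
  then have "AE \<omega> in M. V \<omega> < 1 / real (Suc n)" for n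
    by (subst (asm) prob_eq_0) (auto simp: not_le)
  then have "AE \<omega> in M. \<forall>n. V \<omega> < 1 / real (Suc n)" by (simp add: AE_all_countable)
  then have "AE \<omega> in M. False"
    using assms(3)
  proof eventually_elim
    case (elim \<omega>)
    obtain n where "1 / real (Suc n) < V \<omega>"
      using reals_Archimedean[OF elim(2)] by (auto simp: inverse_eq_divide)
    then show ?case using elim(1) less_asym by blast
  qed
  then show False by simp
qed

section \<open>Servers still busy after one interarrival time\<close>

locale service =
  prob_space M for M :: "'a measure" +
  fixes U :: "'a \<Rightarrow> real" and \<mu> :: real
  assumes meas[measurable]: "U \<in> borel_measurable M"
    and U_nonneg: "AE \<omega> in M. 0 \<le> U \<omega>"
    and U_mean_pos: "0 < (LINT \<omega>|M. U \<omega>)"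
    and \<mu>_pos: "0 < \<mu>"
begin

text \<open>Given \<open>U\<close>, this is the probability that a busy server is still busy at the
  next arrival: the p of the binomial law.\<close>

definition stay :: "'a \<Rightarrow> real" where "stay \<omega> = exp (- \<mu> * U \<omega>)"

lemma stay_measurable[measurable]: "stay \<in> borel_measurable M"
  unfolding stay_def by measurable

lemma stay_pos: "0 < stay \<omega>" by (simp add: stay_def)

lemma stay_le_1: "AE \<omega> in M. stay \<omega> \<le> 1"
  using U_nonneg by eventually_elim (use \<mu>_pos in \<open>simp add: stay_def\<close>)

lemma Bernstein_stay:
  "AE \<omega> in M. 0 \<le> Bernstein n k (stay \<omega>) \<and> Bernstein n k (stay \<omega>) \<le> real (n choose k)"
  using stay_le_1
proof eventually_elim
  case (elim \<omega>)
  have "stay \<omega> ^ k * (1 - stay \<omega>) ^ (n - k) \<le> 1"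
    using elim stay_pos[of \<omega>] by (intro mult_le_one power_le_one) auto
  then have "Bernstein n k (stay \<omega>) \<le> real (n choose k) * 1"
    unfolding Bernstein_def mult.assoc by (intro mult_left_mono) auto
  then show ?case using elim stay_pos[of \<omega>] by (simp add: Bernstein_nonneg)
qed

lemma Bernstein_stay_measurable[measurable]: "(\<lambda>\<omega>. Bernstein n k (stay \<omega>)) \<in> borel_measurable M"
  unfolding Bernstein_def by measurable

lemma integrable_Bernstein: "integrable M (\<lambda>\<omega>. Bernstein n k (stay \<omega>))"
proof (rule integrable_const_bound)
  show "AE \<omega> in M. norm (Bernstein n k (stay \<omega>)) \<le> real (n choose k)"
    using Bernstein_stay[of n k] by eventually_elim simp
qed measurable

lemma integrable_stay_Bernstein: "integrable M (\<lambda>\<omega>. stay \<omega> * Bernstein n k (stay \<omega>))"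
proof (rule integrable_const_bound)
  show "AE \<omega> in M. norm (stay \<omega> * Bernstein n k (stay \<omega>)) \<le> 1 * real (n choose k)"
    using Bernstein_stay[of n k] stay_le_1
  proof eventually_elim
    case (elim \<omega>)
    then show ?case
      using stay_pos[of \<omega>] unfolding norm_mult by (intro mult_mono) auto
  qed
qed measurable

lemma integrable_stay: "integrable M stay"
  using integrable_stay_Bernstein[of 0 0] by (simp add: Bernstein_def)

text \<open>Otherwise the almost surely nonnegative \<open>1 - stay\<close> has mean zero, so
  \<open>U\<close> vanishes almost surely, against its positive mean.\<close>

lemma expectation_stay_less_1: "expectation stay < 1"
proof (rule ccontr)
  assume "\<not> expectation stay < 1"
  then have "expectation (\<lambda>\<omega>. 1 - stay \<omega>) \<le> 0"
    using integrable_stay by (simp add: prob_space)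
  moreover have nn: "AE \<omega> in M. 0 \<le> 1 - stay \<omega>" using stay_le_1 by simp
  ultimately have "expectation (\<lambda>\<omega>. 1 - stay \<omega>) = 0"
    using integral_nonneg_AE[OF nn] by simp
  then have "AE \<omega> in M. 1 - stay \<omega> = 0"
    using integral_nonneg_eq_0_iff_AE[OF _ nn] integrable_stay by simp
  then have "AE \<omega> in M. U \<omega> = 0"
    using \<mu>_pos by (auto simp: stay_def elim!: eventually_mono)
  then have "(LINT \<omega>|M. U \<omega>) = (LINT \<omega>|M. 0)" by (intro integral_cong_AE) auto
  then show False using U_mean_pos by simp
qed

text \<open>Counting the \<open>l\<close> servers that stay instead of the \<open>k - l\<close> that
  leave swaps the success probability for its complement.\<close>

lemma departure_prob_eq:
  assumes "l \<le> k"
  shows "departure_prob M U \<mu> k (k - l) = expectation (\<lambda>\<omega>. Bernstein k l (stay \<omega>))"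
proof -
  have "exp (- real l * \<mu> * U \<omega>) = stay \<omega> ^ l" for \<omega>
    unfolding stay_def exp_of_nat_mult[symmetric] by (simp add: mult.assoc)
  then show ?thesis
    unfolding departure_prob_def Bernstein_def stay_def[symmetric] using assms
    by (intro Bochner_Integration.integral_cong) (auto simp: binomial_symmetric[symmetric] mult_ac)
qed

lemma remaining_le_prob_eq:
  assumes "j \<le> i"
  shows "remaining_le_prob M U \<mu> i j = expectation (\<lambda>\<omega>. \<Sum>l\<le>j. Bernstein i l (stay \<omega>))"
  unfolding remaining_le_prob_def
  using assms by (subst Bochner_Integration.integral_sum) (auto simp: integrable_Bernstein departure_prob_eq)

lemma remaining_le_prob_self: "remaining_le_prob M U \<mu> i i = 1"
  by (simp add: remaining_le_prob_eq prob_space)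

text \<open>The coefficient of \<open>\<Delta> j\<close> in the opportunity cost: one marked server
  stays and \<open>j\<close> of \<open>i\<close> others stay.\<close>

definition weight :: "nat \<Rightarrow> nat \<Rightarrow> real" where
  "weight i j = expectation (\<lambda>\<omega>. stay \<omega> * Bernstein i j (stay \<omega>))"

lemma remaining_le_prob_diff:
  assumes "j \<le> i"
  shows "remaining_le_prob M U \<mu> i j - remaining_le_prob M U \<mu> (Suc i) j = weight i j"
proof -
  have "remaining_le_prob M U \<mu> i j - remaining_le_prob M U \<mu> (Suc i) j
      = expectation (\<lambda>\<omega>. (\<Sum>l\<le>j. Bernstein i l (stay \<omega>)) - (\<Sum>l\<le>j. Bernstein (Suc i) l (stay \<omega>)))"
    using assms by (subst Bochner_Integration.integral_diff) (auto simp: integrable_Bernstein remaining_le_prob_eq)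
  then show ?thesis by (simp add: sum_Bernstein_diff weight_def)
qed

text \<open>All \<open>Suc i\<close> servers stay with conditional probability
  \<open>stay ^ Suc i\<close>, so the separate last term of the opportunity cost fits the pattern of
  the others.\<close>

lemma departure_prob_0: "departure_prob M U \<mu> (Suc i) 0 = weight i i"
  using departure_prob_eq[of "Suc i" "Suc i"] by (simp add: weight_def Bernstein_def)

lemma weight_nonneg: "0 \<le> weight i j"
  unfolding weight_def
proof (rule integral_nonneg_AE)
  show "AE \<omega> in M. 0 \<le> stay \<omega> * Bernstein i j (stay \<omega>)"
    using Bernstein_stay[of i j] by eventually_elim (simp add: less_imp_le[OF stay_pos])
qed

lemma weight_self_pos: "0 < weight i i"
proof -
  have "weight i i = expectation (\<lambda>\<omega>. stay \<omega> ^ Suc i)" by (simp add: weight_def Bernstein_def)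
  moreover have int: "integrable M (\<lambda>\<omega>. stay \<omega> ^ Suc i)"
    using integrable_stay_Bernstein[of i i] by (simp add: Bernstein_def)
  moreover have "expectation (\<lambda>\<omega>. stay \<omega> ^ Suc i) \<noteq> 0"
  proof
    assume "expectation (\<lambda>\<omega>. stay \<omega> ^ Suc i) = 0"
    then have "AE \<omega> in M. stay \<omega> ^ Suc i = 0"
      using stay_pos by (subst (asm) integral_nonneg_eq_0_iff_AE[OF int]) (auto simp: less_imp_le)
    then have "AE \<omega> in M. False"
    proof eventually_elim
      case (elim \<omega>)
      then show ?case using stay_pos[of \<omega>] by simp
    qed
    then show False by simp
  qed
  ultimately show ?thesis using weight_nonneg[of i i] by simp
qed

lemma sum_weight: "(\<Sum>j\<le>i. weight i j) = expectation stay"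
  unfolding weight_def
  by (subst Bochner_Integration.integral_sum[symmetric])
    (auto simp: integrable_stay_Bernstein sum_distrib_left[symmetric])

lemma opportunity_cost_eq: "opportunity_cost M U \<mu> \<Delta> i = (\<Sum>j\<le>i. weight i j * \<Delta> j)"
  unfolding opportunity_cost_def
  by (simp add: remaining_le_prob_diff departure_prob_0 lessThan_Suc_atMost[symmetric])

text \<open>Raising the state by one lowers each coefficient by \<open>weight i j\<close>, and the
  new index \<open>i\<close> enters with \<open>remaining_le_prob M U \<mu> i i = 1\<close>. This is
  what subtracting consecutive Bellman equations requires.\<close>

lemma sum_remaining_le_prob_Suc:
  "(\<Sum>j<Suc i. remaining_le_prob M U \<mu> (Suc i) j * \<Delta> j)
     = (\<Sum>j<i. remaining_le_prob M U \<mu> i j * \<Delta> j) + \<Delta> i - opportunity_cost M U \<mu> \<Delta> i"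
proof -
  have "(\<Sum>j<Suc i. remaining_le_prob M U \<mu> (Suc i) j * \<Delta> j)
      = (\<Sum>j<Suc i. remaining_le_prob M U \<mu> i j * \<Delta> j - weight i j * \<Delta> j)"
    by (intro sum.cong) (auto simp: remaining_le_prob_diff[symmetric] algebra_simps)
  then show ?thesis
    by (simp add: sum_subtractf opportunity_cost_eq lessThan_Suc_atMost[symmetric] remaining_le_prob_self)
qed

end

section \<open>From the Bellman equations to the structural results\<close>

theorem theorem23:
  fixes M :: "'a measure" and V U :: "'a \<Rightarrow> real" and f :: "real \<Rightarrow> ennreal"
    and lam \<mu> \<theta> :: real and K :: nat and \<Delta> u :: "nat \<Rightarrow> real"
  assumes "prob_space M"
    and "V \<in> borel_measurable M"
    and "AE \<omega> in M. V \<omega> > 0"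
    and "continuous_on UNIV (cdf (distr M borel V))"
    and "integrable M V"
    and "distributed M lborel U f"
    and "AE \<omega> in M. U \<omega> \<ge> 0"
    and "integrable M U"
    and "lam > 0"
    and "(LINT \<omega>|M. U \<omega>) = 1 / lam"
    and "\<mu> > 0"
    and "K \<ge> 1"
    and "max_profit M V (opportunity_cost M U \<mu> \<Delta> 0) = \<theta> / lam"
    and "\<And>i. 1 \<le> i \<Longrightarrow> i \<le> K - 1 \<Longrightarrow>
           max_profit M V (opportunity_cost M U \<mu> \<Delta> i)
             + (\<Sum>j<i. remaining_le_prob M U \<mu> i j * \<Delta> j) = \<theta> / lam"
    and "(\<Sum>j<K. remaining_le_prob M U \<mu> K j * \<Delta> j) = \<theta> / lam"
    and "\<And>i. i < K \<Longrightarrow>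
           is_arg_max (\<lambda>v. (v - opportunity_cost M U \<mu> \<Delta> i) * survival M V v) (\<lambda>_. True) (u i)"
  shows "\<theta> \<ge> 0
    \<and> ((\<forall>i<K. \<Delta> i > 0) \<and> strict_mono_on {..<K} \<Delta>
       \<and> (\<forall>i<K. opportunity_cost M U \<mu> \<Delta> i > 0)
       \<and> strict_mono_on {..<K} (opportunity_cost M U \<mu> \<Delta>))
    \<and> mono_on {..<K} u"
proof -
  interpret service M U \<mu>
    by (intro service.intro service_axioms.intro) (use assms in auto)
  let ?b = "opportunity_cost M U \<mu> \<Delta>" and ?g = "survival M V"
  define w where "w i = (u i - ?b i) * ?g (u i)" for i
  note argmax = assms(16)
  note g = survival_nonneg[of M V] survival_le_1[OF assms(1), of V]
  have w: "max_profit M V (?b i) = w i" if "i < K" for i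
    unfolding w_def by (rule max_profit_eq[OF argmax[OF that]])
  have w_ge: "(v - ?b i) * ?g v \<le> w i" if "i < K" for i v
    using argmax[OF that] unfolding w_def by (auto simp: is_arg_max_linorder)
  \<comment> \<open>Charging exactly the cost yields margin zero.\<close>
  have w_nonneg: "0 \<le> w i" if "i < K" for i using w_ge[OF that, of "?b i"] by simp
  \<comment> \<open>For \<open>i = 0\<close> the sum is empty, which absorbs the separate first
    equation.\<close>
  have bellman: "w i + (\<Sum>j<i. remaining_le_prob M U \<mu> i j * \<Delta> j) = \<theta> / lam" if "i < K" for i
    using assms(13) assms(14)[of i] w[OF that] that by (cases "i = 0") auto
  obtain v where v: "v > 0" "?g v > 0" using survival_pos_exists assms(1-3) by blast
  have w_pos: "0 < w i" if "i < K" "?b i \<le> 0" for i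
  proof -
    have "0 < (v - ?b i) * ?g v" using v that by (intro mult_pos_pos) auto
    then show ?thesis using w_ge[OF that(1), of v] by linarith
  qed
  have step: "\<Delta> i = ?b i + w i - w (Suc i)" if "Suc i < K" for i
    using bellman[of i] bellman[of "Suc i"] sum_remaining_le_prob_Suc[of i \<Delta>] that by simp
  \<comment> \<open>The equation for the full system \<open>K\<close> has no margin term, so no next
    margin is subtracted.\<close>
  have last: "\<Delta> i = ?b i + w i" if "Suc i = K" for i
    using bellman[of i] assms(15) sum_remaining_le_prob_Suc[of i \<Delta>] that by auto
  have w_mono: "w j \<le> w i" and w_lip: "w i \<le> w j + (?b j - ?b i)"
    if "i < K" "j < K" "?b i \<le> ?b j" for i j
    using is_arg_max_margin_bounds(1,2)[OF g argmax argmax, OF that] unfolding w_def by auto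
  have w_strict: "w j < w i" if "i < K" "j < K" "?b i < ?b j" "0 < w j" for i j
    using is_arg_max_margin_bounds(3)[OF g argmax argmax, of i j] that unfolding w_def by auto
  note rules = weight_nonneg weight_self_pos sum_weight expectation_stay_less_1 opportunity_cost_eq
    step last w_nonneg w_mono w_lip w_strict w_pos
  note increasing = marginal_values_increasing[where c = weight and q = "expectation stay" and b = ?b
      and w = w and K = K]
  have \<Delta>_pos: "0 < \<Delta> i" if "i < K" for i
    by (rule increasing(1)) (assumption | rule rules that)+
  have b_pos: "0 < ?b i" if "i < K" for i
    by (rule increasing(2)) (assumption | rule rules that)+
  have w_pos': "0 < w i" if "i < K" for i
    by (rule increasing(3)) (assumption | rule rules that)+
  have \<Delta>_mono: "strict_mono_on {..<K} \<Delta>" by (rule increasing(4)) (assumption | rule rules)+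
  have b_mono: "strict_mono_on {..<K} ?b" by (rule increasing(5)) (assumption | rule rules)+
  have "mono_on {..<K} u"
  proof (rule mono_onI)
    fix r s assume *: "r \<in> {..<K}" "s \<in> {..<K}" "r \<le> s"
    show "u r \<le> u s"
    proof (cases "r = s")
      case False
      then have "?b r < ?b s" using * b_mono by (auto simp: strict_mono_on_def)
      then show ?thesis
        using is_arg_max_margin_mono[OF g(1) antimono_survival argmax argmax, of r s]
          assms(1,2) w_pos'[of s] * unfolding w_def by auto
    qed simp
  qed
  \<comment> \<open>The equation for state 0 identifies this quotient with the margin
    \<open>w 0\<close>.\<close>
  moreover have "0 \<le> \<theta> / lam" using w_nonneg[of 0] w[of 0] assms(12,13) by simp
  ultimately show ?thesis
    using \<Delta>_pos b_pos \<Delta>_mono b_mono assms(9) by (auto simp: zero_le_divide_iff)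
qed

end
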